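(* Let $f$ be any modulus function. Then (i) $w^{\beta,0}(F,f)\subset w^{\beta,\infty}(F,f)$ for every real $\beta>0$; (ii) $w^{\beta}(F,f)\subset w^{\beta,\infty}(F,f)$ for every real $\beta\ge1$.
   Context: A fuzzy number is a function $u:\mathbb{R}\to[0,1]$ such that (i) $u(x_0)=1$ for some $x_0\in\mathbb{R}$; (ii) $u(\lambda x+(1-\lambda)y)\ge\min[u(x),u(y)]$ for all $x,y\in\mathbb{R}$, $0\le\lambda\le1$; (iii) $u$ is upper semicontinuous; (iv) $\operatorname{supp}u=\mathrm{cl}\{x\in\mathbb{R}:u(x)>0\}$ is compact. The $\alpha$-level set is $[u]^{\alpha}=\{x:u(x)\ge\alpha\}$ for $\alpha\in(0,1]$ and $[u]^0=\operatorname{supp}u$; each is a closed interval $[\underline{u}^{\alpha},\overline{u}^{\alpha}]$. $L(\mathbb{R})$ denotes the set of fuzzy numbers, with metric $d(u,v)=\sup_{0\le\alpha\le1}\max\{|\underline{u}^{\alpha}-\underline{v}^{\alpha}|,|\overline{u}^{\alpha}-\overline{v}^{\alpha}|\}$. $\bar 0$ is the fuzzy number with $\bar0(0)=1$ and $\bar0(x)=0$ for $x\ne0$. $s(F)$ is the set of all sequences $X=(X_k)_{k\ge1}$ of fuzzy numbers. A modulus function is a map $f:[0,\infty)\to[0,\infty)$ such that $f(x)=0$ iff $x=0$; $f(x+y)\le f(x)+f(y)$ for $x,y\ge0$; $f$ is increasing (i.e. $x\le y$ implies $f(x)\le f(y)$); and $f$ is right-continuous at $0$. For a modulus function $f$ and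 real $\beta>0$: $w^{\beta,0}(F,f)=\{X\in s(F):\lim_{n\to\infty}\frac{1}{n^{\beta}}\sum_{k=1}^{n}f(d(X_k,\bar0))=0\}$; $w^{\beta}(F,f)=\{X\in s(F):\lim_{n\to\infty}\frac{1}{n^{\beta}}\sum_{k=1}^{n}f(d(X_k,X_0))=0\text{ for some }X_0\in L(\mathbb{R})\}$; $w^{\beta,\infty}(F,f)=\{X\in s(F):\sup_{n}\frac{1}{n^{\beta}}\sum_{k=1}^{n}f(d(X_k,\bar0))<\infty\}$. The symbol $\subset$ allows equality. *)

theory Defs
  imports "HOL-Analysis.Analysis"
begin

definition upper_semicontinuous :: "(real \<Rightarrow> real) \<Rightarrow> bool" where
  "upper_semicontinuous u \<longleftrightarrow> (\<forall>x. \<forall>c>u x. \<forall>\<^sub>F y in nhds x. u y < c)"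

definition fuzzy_supp :: "(real \<Rightarrow> real) \<Rightarrow> real set" where
  "fuzzy_supp u = closure {x. u x > 0}"

definition fuzzy_numbers :: "(real \<Rightarrow> real) set" where
  "fuzzy_numbers = {u.
     range u \<subseteq> {0..1} \<and>
     (\<exists>x0. u x0 = 1) \<and>
     (\<forall>x y t. 0 \<le> t \<and> t \<le> 1 \<longrightarrow> u (t * x + (1 - t) * y) \<ge> min (u x) (u y)) \<and>
     upper_semicontinuous u \<and>
     compact (fuzzy_supp u)}"

definition level_set :: "(real \<Rightarrow> real) \<Rightarrow> real \<Rightarrow> real set" where
  "level_set u \<alpha> = (if \<alpha> = 0 then fuzzy_supp u else {x. u x \<ge> \<alpha>})"

definition lower_end :: "(real \<Rightarrow> real) \<Rightarrow> real \<Rightarrow> real" where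
  "lower_end u \<alpha> = Inf (level_set u \<alpha>)"

definition upper_end :: "(real \<Rightarrow> real) \<Rightarrow> real \<Rightarrow> real" where
  "upper_end u \<alpha> = Sup (level_set u \<alpha>)"

definition fuzzy_dist :: "(real \<Rightarrow> real) \<Rightarrow> (real \<Rightarrow> real) \<Rightarrow> real" where
  "fuzzy_dist u v =
     (SUP \<alpha>\<in>{0..1}. max \<bar>lower_end u \<alpha> - lower_end v \<alpha>\<bar> \<bar>upper_end u \<alpha> - upper_end v \<alpha>\<bar>)"

definition fuzzy_zero :: "real \<Rightarrow> real" where
  "fuzzy_zero x = (if x = 0 then 1 else 0)"

text \<open>The next two lemmas show that on fuzzy numbers the totalised operators \<open>Inf\<close>, \<open>Sup\<close> and
  \<open>SUP\<close> above take their intended values: level sets are the nonempty closed intervals between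
  their end points, and the supremum defining the distance is over a bounded family.\<close>

lemma level_set_eq_Icc:
  assumes u: "u \<in> fuzzy_numbers" and a: "\<alpha> \<in> {0..1}"
  shows "level_set u \<alpha> = {lower_end u \<alpha>..upper_end u \<alpha>}" "lower_end u \<alpha> \<le> upper_end u \<alpha>"
proof -
  from u obtain x0 where x0: "u x0 = 1" by (auto simp: fuzzy_numbers_def)
  from u have qc: "\<And>x y t. 0 \<le> t \<Longrightarrow> t \<le> 1 \<Longrightarrow> u (t * x + (1 - t) * y) \<ge> min (u x) (u y)"
    and usc: "upper_semicontinuous u" and cs: "compact (fuzzy_supp u)"
    by (auto simp: fuzzy_numbers_def)
  have cv: "convex {x. P (u x)}" if P: "\<And>r s. r \<le> s \<Longrightarrow> P r \<Longrightarrow> P s" for P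
  proof (rule convexI)
    fix x y s t :: real
    assume h: "x \<in> {x. P (u x)}" "y \<in> {x. P (u x)}" "0 \<le> s" "0 \<le> t" "s + t = 1"
    then have t: "t = 1 - s" by simp
    have "P (min (u x) (u y))" using h by (auto simp: min_def)
    with P[OF qc[of s x y]] h t show "s *\<^sub>R x + t *\<^sub>R y \<in> {x. P (u x)}" by simp
  qed
  have ne: "x0 \<in> level_set u \<alpha>"
    using x0 a closure_subset[of "{x. u x > 0}"] by (auto simp: level_set_def fuzzy_supp_def)
  have "compact (level_set u \<alpha>) \<and> convex (level_set u \<alpha>)"
  proof (cases "\<alpha> = 0")
    case True
    have "convex {x. 0 < u x}" by (rule cv) auto
    then show ?thesis using True cs by (auto simp: level_set_def fuzzy_supp_def convex_closure)
  next
    case False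
    have "open {x. u x < \<alpha>}"
    proof (subst open_subopen, intro ballI)
      fix x assume "x \<in> {x. u x < \<alpha>}"
      then have "\<forall>\<^sub>F y in nhds x. u y < \<alpha>"
        using usc unfolding upper_semicontinuous_def by simp
      then show "\<exists>T. open T \<and> x \<in> T \<and> T \<subseteq> {x. u x < \<alpha>}"
        unfolding eventually_nhds by blast
    qed
    then have "closed {x. u x \<ge> \<alpha>}"
      by (simp add: closed_def Compl_eq not_le)
    moreover have "{x. u x \<ge> \<alpha>} \<subseteq> fuzzy_supp u"
    proof -
      have "{x. u x \<ge> \<alpha>} \<subseteq> {x. u x > 0}" using False a by auto
      then show ?thesis unfolding fuzzy_supp_def using closure_subset by (rule subset_trans)
    qed
    ultimately have "compact {x. u x \<ge> \<alpha>}"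
      using compact_Int_closed[OF cs, of "{x. u x \<ge> \<alpha>}"] by (simp add: Int_absorb1)
    moreover have "convex {x. \<alpha> \<le> u x}" by (rule cv) auto
    ultimately show ?thesis using False by (simp add: level_set_def)
  qed
  then obtain l r where lr: "level_set u \<alpha> = {l..r}"
    using connected_compact_interval_1[of "level_set u \<alpha>"] convex_connected by auto
  with ne have le: "l \<le> r" by auto
  from lr le show "level_set u \<alpha> = {lower_end u \<alpha>..upper_end u \<alpha>}" "lower_end u \<alpha> \<le> upper_end u \<alpha>"
    by (simp_all add: lower_end_def upper_end_def)
qed

lemma bdd_above_fuzzy_dist:
  assumes u: "u \<in> fuzzy_numbers" and v: "v \<in> fuzzy_numbers"
  shows "bdd_above ((\<lambda>\<alpha>. max \<bar>lower_end u \<alpha> - lower_end v \<alpha>\<bar> \<bar>upper_end u \<alpha> - upper_end v \<alpha>\<bar>) ` {0..1})"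
proof -
  have *: "lower_end w 0 \<le> lower_end w \<alpha> \<and> lower_end w \<alpha> \<le> upper_end w \<alpha> \<and> upper_end w \<alpha> \<le> upper_end w 0"
    if w: "w \<in> fuzzy_numbers" and a: "\<alpha> \<in> {0..1}" for w \<alpha>
  proof -
    have "level_set w \<alpha> \<subseteq> level_set w 0"
    proof
      fix x assume x: "x \<in> level_set w \<alpha>"
      show "x \<in> level_set w 0"
      proof (cases "\<alpha> = 0")
        case False
        with a x have "x \<in> {x. w x > 0}" by (simp add: level_set_def)
        then show ?thesis
          using closure_subset[of "{x. w x > 0}"]
          unfolding level_set_def fuzzy_supp_def by (simp add: subsetD)
      qed (use x in simp)
    qed
    then show ?thesis using level_set_eq_Icc[OF w a] level_set_eq_Icc[OF w, of 0] by auto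
  qed
  show ?thesis
  proof (rule bdd_aboveI2)
    fix \<alpha> :: real assume "\<alpha> \<in> {0..1}"
    from *[OF u this] *[OF v this]
    show "max \<bar>lower_end u \<alpha> - lower_end v \<alpha>\<bar> \<bar>upper_end u \<alpha> - upper_end v \<alpha>\<bar>
        \<le> \<bar>lower_end u 0\<bar> + \<bar>upper_end u 0\<bar> + \<bar>lower_end v 0\<bar> + \<bar>upper_end v 0\<bar>" by linarith
  qed
qed

lemma fuzzy_zero_in_fuzzy_numbers: "fuzzy_zero \<in> fuzzy_numbers"
proof -
  have s: "{x. 0 < fuzzy_zero x} = {0}" by (auto simp: fuzzy_zero_def)
  have "upper_semicontinuous fuzzy_zero"
    unfolding upper_semicontinuous_def
  proof (intro allI impI)
    fix x c :: real assume c: "fuzzy_zero x < c"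
    show "\<forall>\<^sub>F y in nhds x. fuzzy_zero y < c"
    proof (cases "x = 0")
      case True
      with c have "1 < c" by (simp add: fuzzy_zero_def)
      then show ?thesis by (auto simp: fuzzy_zero_def intro!: always_eventually)
    next
      case False
      then have "\<forall>\<^sub>F y in nhds x. y \<in> - {0}" by (intro eventually_nhds_in_open) auto
      then show ?thesis by eventually_elim (use c False in \<open>auto simp: fuzzy_zero_def\<close>)
    qed
  qed
  then show ?thesis
    unfolding fuzzy_numbers_def fuzzy_supp_def s by (auto simp: fuzzy_zero_def)
qed

text \<open>A modulus is a function on \<open>[0,\<infinity>)\<close>; its values at negative arguments are irrelevant.\<close>

definition modulus_function :: "(real \<Rightarrow> real) \<Rightarrow> bool" where
  "modulus_function f \<longleftrightarrow>
     f ` {0..} \<subseteq> {0..} \<and>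
     (\<forall>x\<ge>0. f x = 0 \<longleftrightarrow> x = 0) \<and>
     (\<forall>x\<ge>0. \<forall>y\<ge>0. f (x + y) \<le> f x + f y) \<and>
     mono_on {0..} f \<and>
     (f \<longlongrightarrow> f 0) (at_right 0)"

text \<open>Sequences are indexed by \<open>k \<ge> 1\<close>, hence extensional functions on \<open>{1..}\<close>.\<close>

definition fuzzy_seqs :: "(nat \<Rightarrow> real \<Rightarrow> real) set" where
  "fuzzy_seqs = {1..} \<rightarrow>\<^sub>E fuzzy_numbers"

definition w_zero :: "real \<Rightarrow> (real \<Rightarrow> real) \<Rightarrow> (nat \<Rightarrow> real \<Rightarrow> real) set" where
  "w_zero \<beta> f = {X \<in> fuzzy_seqs.
     (\<lambda>n. 1 / (real n powr \<beta>) * (\<Sum>k=1..n. f (fuzzy_dist (X k) fuzzy_zero))) \<longlonglongrightarrow> 0}"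

definition w_conv :: "real \<Rightarrow> (real \<Rightarrow> real) \<Rightarrow> (nat \<Rightarrow> real \<Rightarrow> real) set" where
  "w_conv \<beta> f = {X \<in> fuzzy_seqs. \<exists>X0\<in>fuzzy_numbers.
     (\<lambda>n. 1 / (real n powr \<beta>) * (\<Sum>k=1..n. f (fuzzy_dist (X k) X0))) \<longlonglongrightarrow> 0}"

definition w_bounded :: "real \<Rightarrow> (real \<Rightarrow> real) \<Rightarrow> (nat \<Rightarrow> real \<Rightarrow> real) set" where
  "w_bounded \<beta> f = {X \<in> fuzzy_seqs.
     bdd_above ((\<lambda>n. 1 / (real n powr \<beta>) * (\<Sum>k=1..n. f (fuzzy_dist (X k) fuzzy_zero))) ` {1..})}"

end

theory Submission
  imports Defs
begin

text \<open>Write \<open>S\<^sub>n(Y)\<close> for the weighted mean \<open>n\<^sup>-\<^sup>\<beta> \<Sum>\<^sub>k f (d (X\<^sub>k, Y))\<close>, and \<open>0\<close> also for the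
  fuzzy zero. A convergent real sequence is
  bounded, which is already the first inclusion. For the second, the triangle inequality for \<open>d\<close>
  and the monotonicity and subadditivity of \<open>f\<close> bound each summand of \<open>S\<^sub>n(0)\<close> by
  \<open>f (d (X\<^sub>k, X\<^sub>0)) + f (d (X\<^sub>0, 0))\<close>, so that
  \<open>S\<^sub>n(0) \<le> S\<^sub>n(X\<^sub>0) + n\<^sup>1\<^sup>-\<^sup>\<beta> f (d (X\<^sub>0, 0))\<close>. The mean \<open>S\<^sub>n(X\<^sub>0)\<close> is bounded because it
  converges, and the other term is bounded because \<open>\<beta> \<ge> 1\<close> keeps \<open>n\<^sup>1\<^sup>-\<^sup>\<beta>\<close> at
  most \<open>1\<close>.\<close>

lemma fuzzy_dist_nonneg:
  assumes "u \<in> fuzzy_numbers" "v \<in> fuzzy_numbers"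
  shows "0 \<le> fuzzy_dist u v"
proof -
  have "0 \<le> max \<bar>lower_end u 0 - lower_end v 0\<bar> \<bar>upper_end u 0 - upper_end v 0\<bar>"
    by simp
  also have "\<dots> \<le> fuzzy_dist u v"
    unfolding fuzzy_dist_def by (rule cSUP_upper[OF _ bdd_above_fuzzy_dist[OF assms]]) simp
  finally show ?thesis .
qed

lemma fuzzy_dist_triangle:
  assumes u: "u \<in> fuzzy_numbers" and v: "v \<in> fuzzy_numbers" and w: "w \<in> fuzzy_numbers"
  shows "fuzzy_dist u w \<le> fuzzy_dist u v + fuzzy_dist v w"
proof -
  let ?D = "\<lambda>u v \<alpha>. max \<bar>lower_end u \<alpha> - lower_end v \<alpha>\<bar> \<bar>upper_end u \<alpha> - upper_end v \<alpha>\<bar>"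
  have "?D u w \<alpha> \<le> fuzzy_dist u v + fuzzy_dist v w" if \<alpha>: "\<alpha> \<in> {0..1}" for \<alpha>
  proof -
    have "?D u w \<alpha> \<le> ?D u v \<alpha> + ?D v w \<alpha>"
      by linarith
    moreover have "?D u v \<alpha> \<le> fuzzy_dist u v"
      unfolding fuzzy_dist_def by (rule cSUP_upper[OF \<alpha> bdd_above_fuzzy_dist[OF u v]])
    moreover have "?D v w \<alpha> \<le> fuzzy_dist v w"
      unfolding fuzzy_dist_def by (rule cSUP_upper[OF \<alpha> bdd_above_fuzzy_dist[OF v w]])
    ultimately show ?thesis
      by linarith
  qed
  then show ?thesis
    unfolding fuzzy_dist_def[of u w] by (intro cSUP_least) auto
qed

lemma modulus_fuzzy_dist_triangle:
  assumes f: "modulus_function f"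
    and u: "u \<in> fuzzy_numbers" and v: "v \<in> fuzzy_numbers" and w: "w \<in> fuzzy_numbers"
  shows "f (fuzzy_dist u w) \<le> f (fuzzy_dist u v) + f (fuzzy_dist v w)"
proof -
  note nn = fuzzy_dist_nonneg[OF u v] fuzzy_dist_nonneg[OF v w] fuzzy_dist_nonneg[OF u w]
  have "mono_on {0..} f"
    using f by (simp add: modulus_function_def)
  then have "f (fuzzy_dist u w) \<le> f (fuzzy_dist u v + fuzzy_dist v w)"
    by (rule mono_onD) (use nn fuzzy_dist_triangle[OF u v w] in auto)
  also have "\<dots> \<le> f (fuzzy_dist u v) + f (fuzzy_dist v w)"
    using f nn unfolding modulus_function_def by blast
  finally show ?thesis .
qed

lemma convergent_imp_bdd_above_image:
  fixes a :: "nat \<Rightarrow> real"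
  assumes "a \<longlonglongrightarrow> l"
  shows "bdd_above (a ` A)"
proof -
  have "bounded (range a)"
    using assms by (rule convergent_imp_bounded)
  then show ?thesis
    by (meson bdd_above_mono bounded_imp_bdd_above image_mono subset_UNIV)
qed

lemma w_zero_subset_w_bounded: "w_zero \<beta> f \<subseteq> w_bounded \<beta> f"
  by (auto simp: w_zero_def w_bounded_def simp del: One_nat_def intro: convergent_imp_bdd_above_image)

lemma w_conv_subset_w_bounded:
  assumes f: "modulus_function f" and \<beta>: "1 \<le> \<beta>"
  shows "w_conv \<beta> f \<subseteq> w_bounded \<beta> f"
proof
  fix X assume "X \<in> w_conv \<beta> f"
  then obtain X0 where X: "X \<in> fuzzy_seqs" and X0: "X0 \<in> fuzzy_numbers"
    and lim: "(\<lambda>n. 1 / (real n powr \<beta>) * (\<Sum>k=1..n. f (fuzzy_dist (X k) X0))) \<longlonglongrightarrow> 0"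
    unfolding w_conv_def by blast
  define C where "C = f (fuzzy_dist X0 fuzzy_zero)"
  have C: "0 \<le> C"
    using f fuzzy_dist_nonneg[OF X0 fuzzy_zero_in_fuzzy_numbers]
    unfolding C_def modulus_function_def by auto
  obtain M where M: "1 / (real n powr \<beta>) * (\<Sum>k=1..n. f (fuzzy_dist (X k) X0)) \<le> M" for n
    using convergent_imp_bdd_above_image[OF lim, of UNIV] by (auto simp: bdd_above_def)
  have "1 / (real n powr \<beta>) * (\<Sum>k=1..n. f (fuzzy_dist (X k) fuzzy_zero)) \<le> M + C"
    if n: "n \<in> {1..}" for n
  proof -
    have "(\<Sum>k=1..n. f (fuzzy_dist (X k) fuzzy_zero)) \<le> (\<Sum>k=1..n. f (fuzzy_dist (X k) X0) + C)"
    proof (rule sum_mono)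
      fix k assume "k \<in> {1..n}"
      then have "X k \<in> fuzzy_numbers"
        using X by (auto simp: fuzzy_seqs_def)
      then show "f (fuzzy_dist (X k) fuzzy_zero) \<le> f (fuzzy_dist (X k) X0) + C"
        unfolding C_def by (rule modulus_fuzzy_dist_triangle[OF f _ X0 fuzzy_zero_in_fuzzy_numbers])
    qed
    then have "1 / (real n powr \<beta>) * (\<Sum>k=1..n. f (fuzzy_dist (X k) fuzzy_zero))
        \<le> 1 / (real n powr \<beta>) * ((\<Sum>k=1..n. f (fuzzy_dist (X k) X0)) + real n * C)"
      by (intro mult_left_mono) (auto simp: sum.distrib)
    also have "\<dots> = 1 / (real n powr \<beta>) * (\<Sum>k=1..n. f (fuzzy_dist (X k) X0))
        + real n / (real n powr \<beta>) * C"
      by (simp add: algebra_simps add_divide_distrib)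
    also have "\<dots> \<le> M + C"
    proof (rule add_mono[OF M])
      have "real n \<le> real n powr \<beta>"
        using powr_mono[OF \<beta>, of "real n"] n by simp
      then have "real n / (real n powr \<beta>) \<le> 1"
        using n by (simp add: divide_le_eq)
      then show "real n / (real n powr \<beta>) * C \<le> C"
        using mult_right_mono[OF _ C] by fastforce
    qed
    finally show ?thesis .
  qed
  then show "X \<in> w_bounded \<beta> f"
    using X unfolding w_bounded_def by (auto intro!: bdd_aboveI2)
qed

theorem theorem3p11:
  fixes f :: "real \<Rightarrow> real"
  assumes "modulus_function f"
  shows "(\<forall>\<beta>::real. \<beta> > 0 \<longrightarrow> w_zero \<beta> f \<subseteq> w_bounded \<beta> f) \<and>
         (\<forall>\<beta>::real. \<beta> \<ge> 1 \<longrightarrow> w_conv \<beta> f \<subseteq> w_bounded \<beta> f)"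
  using w_zero_subset_w_bounded w_conv_subset_w_bounded[OF assms] by blast

end
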